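(* The extended Okubic affine plane $\overline{\mathscr{A}_2}(\mathcal{O})$ is a projective plane: any two distinct points are incident to a unique line; any two distinct lines are incident to a unique common point; and there exist four points such that no three of them are incident to a common line.
   Context: The real Okubo algebra $\mathcal{O}$ is the 8-dimensional real vector space of $3\times 3$ complex Hermitian traceless matrices with bilinear product $x*y=\mu\,xy+\overline{\mu}\,yx-\frac13\mathrm{Tr}(xy)\,I$, where $\mu=\frac16(3+\mathrm{i}\sqrt3)$ and juxtaposition is the matrix product. The extended (completed) Okubic affine plane $\overline{\mathscr{A}_2}(\mathcal{O})$ has as points the pairs $(x,y)\in\mathcal{O}^2$, the points at infinity $(s)$ for $s\in\mathcal{O}$, and a point $(\infty)$. Its lines are $[s,t]=\{(x,s*x+t):x\in\mathcal{O}\}\cup\{(s)\}$ for $s,t\in\mathcal{O}$; the vertical lines $[c]=(\{c\}\times\mathcal{O})\cup\{(\infty)\}$ for $c\in\mathcal{O}$; and the line at infinity $[\infty]=\{(s):s\in\mathcal{O}\}\cup\{(\infty)\}$. Incidence is membership. *)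

theory Defs
  imports "HOL-Analysis.Analysis"
begin

definition hermitian :: "complex^'n^'n \<Rightarrow> bool" where
  "hermitian A \<longleftrightarrow> (\<forall>i j. A $ i $ j = cnj (A $ j $ i))"

text \<open>The Okubo algebra, as a real subspace of the complex \<open>3 \<times> 3\<close> matrices.\<close>

definition okubo :: "(complex^3^3) set" where
  "okubo = {A. hermitian A \<and> trace A = 0}"

definition okubo_mu :: complex where
  "okubo_mu = (3 + \<i> * complex_of_real (sqrt 3)) / 6"

text \<open>Complex scalars act entrywise; the library only provides real scalar multiplication
  \<open>*\<^sub>R\<close> on matrices, and \<open>*s\<close> takes scalars from the type of the rows.
  The scalar matrix \<open>mat c\<close> is \<open>c I\<close>.\<close>

definition cscale :: "complex \<Rightarrow> complex^'n^'m \<Rightarrow> complex^'n^'m" where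
  "cscale c A = (\<chi> i j. c * A $ i $ j)"

definition okubo_mult :: "complex^3^3 \<Rightarrow> complex^3^3 \<Rightarrow> complex^3^3" where
  "okubo_mult x y =
     cscale okubo_mu (x ** y) + cscale (cnj okubo_mu) (y ** x) - mat (trace (x ** y) / 3)"

lemma hermitian_cnj: "hermitian A \<Longrightarrow> cnj (A $ i $ j) = A $ j $ i"
  unfolding hermitian_def by (metis complex_cnj_cnj)

lemma hermitianI: "(\<And>i j. cnj (A $ i $ j) = A $ j $ i) \<Longrightarrow> hermitian A"
  unfolding hermitian_def by metis

lemma subspace_okubo: "subspace okubo"
proof (rule subspaceI)
  show "0 \<in> okubo"
    by (simp add: okubo_def hermitian_def trace_def)
next
  fix x y assume "x \<in> okubo" "y \<in> okubo"
  then show "x + y \<in> okubo"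
    by (auto simp: okubo_def trace_add hermitian_cnj intro!: hermitianI)
next
  fix c :: real and x assume x: "x \<in> okubo"
  have "trace (c *\<^sub>R x) = c *\<^sub>R trace x"
    by (simp add: trace_def scaleR_sum_right)
  then show "c *\<^sub>R x \<in> okubo"
    using x by (auto simp: okubo_def hermitian_cnj intro!: hermitianI)
qed

lemma okubo_mult_closed:
  assumes "x \<in> okubo" "y \<in> okubo"
  shows "okubo_mult x y \<in> okubo"
proof -
  have hx: "cnj (x $ i $ j) = x $ j $ i" and hy: "cnj (y $ i $ j) = y $ j $ i" for i j
    using assms by (simp_all add: okubo_def hermitian_cnj)
  have cx: "cnj ((x ** y) $ i $ j) = (y ** x) $ j $ i"
    and cy: "cnj ((y ** x) $ i $ j) = (x ** y) $ j $ i" for i j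
    by (simp_all add: matrix_matrix_mult_def hx hy mult.commute)
  have tr: "trace (y ** x) = trace (x ** y)"
    by (rule trace_mul_sym)
  have ct: "cnj (trace (x ** y)) = trace (x ** y)"
  proof -
    have "cnj (trace (x ** y)) = trace (y ** x)"
      by (simp add: trace_def cx)
    then show ?thesis by (simp add: tr)
  qed
  have mu: "okubo_mu + cnj okubo_mu = 1"
    by (simp add: okubo_mu_def complex_eq_iff)
  have "hermitian (okubo_mult x y)"
    unfolding okubo_mult_def
    by (rule hermitianI) (simp add: cscale_def mat_def cx cy ct)
  moreover have "trace (okubo_mult x y) = 0"
  proof -
    have "trace (okubo_mult x y) =
        okubo_mu * trace (x ** y) + cnj okubo_mu * trace (y ** x) - trace (x ** y)"
      by (simp add: okubo_mult_def cscale_def mat_def trace_def sum.distrib sum_subtractf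
          flip: sum_distrib_left)
    also have "\<dots> = (okubo_mu + cnj okubo_mu) * trace (x ** y) - trace (x ** y)"
      by (simp add: tr algebra_simps)
    finally show ?thesis by (simp add: mu)
  qed
  ultimately show ?thesis by (simp add: okubo_def)
qed

datatype 'a point = Affine 'a 'a | Slope 'a | Infinity

definition okubic_points :: "(complex^3^3) point set" where
  "okubic_points =
     {Affine x y | x y. x \<in> okubo \<and> y \<in> okubo} \<union> {Slope s | s. s \<in> okubo} \<union> {Infinity}"

definition line :: "complex^3^3 \<Rightarrow> complex^3^3 \<Rightarrow> (complex^3^3) point set" where
  "line s t = {Affine x (okubo_mult s x + t) | x. x \<in> okubo} \<union> {Slope s}"

definition vertical_line :: "complex^3^3 \<Rightarrow> (complex^3^3) point set" where
  "vertical_line c = {Affine c y | y. y \<in> okubo} \<union> {Infinity}"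

definition line_at_infinity :: "(complex^3^3) point set" where
  "line_at_infinity = {Slope s | s. s \<in> okubo} \<union> {Infinity}"

definition okubic_lines :: "(complex^3^3) point set set" where
  "okubic_lines =
     {line s t | s t. s \<in> okubo \<and> t \<in> okubo} \<union> {vertical_line c | c. c \<in> okubo} \<union>
     {line_at_infinity}"

definition projective_plane :: "'p set \<Rightarrow> 'p set set \<Rightarrow> bool" where
  "projective_plane P L \<longleftrightarrow>
     (\<forall>p\<in>P. \<forall>q\<in>P. p \<noteq> q \<longrightarrow> (\<exists>!l. l \<in> L \<and> p \<in> l \<and> q \<in> l)) \<and>
     (\<forall>l\<in>L. \<forall>m\<in>L. l \<noteq> m \<longrightarrow> (\<exists>!p. p \<in> P \<and> p \<in> l \<and> p \<in> m)) \<and>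
     (\<exists>Q\<subseteq>P. card Q = 4 \<and> (\<forall>T\<subseteq>Q. card T = 3 \<longrightarrow> \<not> (\<exists>l\<in>L. T \<subseteq> l)))"

end

theory Submission
  imports Defs
begin

text \<open>The completed plane over a real algebra is projective as soon as the algebra is a division
  algebra. Two affine points with distinct abscissae lie on a common line \<open>[s, t]\<close> exactly when
  \<open>s * (x - x') = y - y'\<close>, and two lines of distinct slopes meet over \<open>x\<close> exactly when
  \<open>(s - s') * x = t' - t\<close>. So joins come from solving \<open>s * a = b\<close> for \<open>s\<close>, meets from solving
  \<open>a * x = b\<close> for \<open>x\<close>, and uniqueness of both from the absence of zero divisors.

  That the Okubo algebra is a division algebra follows from its being a symmetric composition
  algebra with a positive definite norm:
  \<open>(x * y) * x = x * (y * x) = (|x|\<^sup>2 / 6) y\<close> (lemma \<open>okubo_mult_composition\<close>), where \<open>|x|\<close> is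
  the Euclidean norm of the matrix \<open>x\<close>. For \<open>x\<close> nonzero the two identities give an explicit
  solution of \<open>x * z = b\<close> and of \<open>z * x = b\<close>, namely a multiple of \<open>b * x\<close> and of \<open>x * b\<close>. The
  choice of \<open>\<mu>\<close> enters through \<open>\<mu> + cnj \<mu> = 1\<close> and \<open>\<mu> cnj \<mu> = 1/3\<close>: they make the
  coefficients of \<open>xxy\<close>, \<open>xyx\<close> and \<open>yxx\<close> in \<open>(x * y) * x\<close> all equal to \<open>1/3\<close>, so that the linearized
  Cayley-Hamilton identity (lemma \<open>polarized_Cayley_Hamilton\<close>) applies. Being Hermitian is what
  turns the quadratic form \<open>tr (x\<^sup>2)\<close> in the answer into \<open>|x|\<^sup>2\<close>.

  In a plane of this kind, uniqueness of joins and of meets is one and the same fact, that two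
  lines sharing two points coincide (lemma \<open>okubic_lines_determined\<close>).\<close>

section \<open>Complex scalars in matrix products\<close>

lemma cscale_nth [simp]: "cscale c A $ i $ j = c * A $ i $ j"
  by (simp add: cscale_def)

lemma cscale_mult_left: "cscale c A ** B = cscale c (A ** B)"
  by (simp add: vec_eq_iff matrix_matrix_mult_def sum_distrib_left mult.assoc)

lemma cscale_mult_right: "A ** cscale c B = cscale c (A ** B)"
  by (simp add: vec_eq_iff matrix_matrix_mult_def sum_distrib_left mult.left_commute)

lemma mat_mult_left: "mat c ** A = cscale c A"
  by (simp add: vec_eq_iff matrix_matrix_mult_def mat_def if_distrib [of "\<lambda>u. u * _"]
      sum.delta' cong: if_cong)

lemma mat_mult_right: "A ** mat c = cscale c A"
  by (simp add: vec_eq_iff matrix_matrix_mult_def mat_def if_distrib [of "\<lambda>u. _ * u"]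
      sum.delta mult.commute cong: if_cong)

lemma trace_cscale: "trace (cscale c A) = c * trace A"
  by (simp add: trace_def sum_distrib_left)

lemma matrix_mult_add_left:
  fixes A B :: "'a::ring_1^'n^'m"
  shows "(A + B) ** C = A ** C + B ** C"
  by (simp add: vec_eq_iff matrix_matrix_mult_def distrib_right sum.distrib)

lemma matrix_mult_diff_left:
  fixes A B :: "'a::ring_1^'n^'m"
  shows "(A - B) ** C = A ** C - B ** C"
  by (simp add: vec_eq_iff matrix_matrix_mult_def left_diff_distrib sum_subtractf)

lemma matrix_mult_diff_right:
  fixes A :: "'a::ring_1^'n^'m"
  shows "A ** (B - C) = A ** B - A ** C"
  by (simp add: vec_eq_iff matrix_matrix_mult_def right_diff_distrib sum_subtractf)

text \<open>Lets an equation between matrices that contains scalar matrices be checked entrywise without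
  a case split on the diagonal.\<close>

lemma mat_nth_eq: "mat c $ i $ j = c * mat 1 $ i $ j" for c :: "'a::semiring_1"
  by (simp add: mat_def)

lemma scaleR_eq_cscale: "k *\<^sub>R A = cscale (complex_of_real k) A"
  by (simp add: vec_eq_iff scaleR_conv_of_real [where 'a = complex])

lemmas matrix_expand = matrix_add_ldistrib matrix_mult_add_left matrix_mult_diff_left
  matrix_mult_diff_right cscale_mult_left cscale_mult_right mat_mult_left mat_mult_right
  trace_add trace_sub trace_cscale

section \<open>Okubo multiplication as a symmetric composition\<close>

lemma okubo_mu_add_cnj: "okubo_mu + cnj okubo_mu = 1"
  by (simp add: okubo_mu_def complex_eq_iff)

lemma okubo_mu_mult_cnj: "okubo_mu * cnj okubo_mu = 1 / 3"
  by (simp add: okubo_mu_def complex_eq_iff field_simps)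

text \<open>Bilinearity lets the difference of two incidence equations be read as a single product of
  differences.\<close>

lemma bilinear_okubo_mult: "bilinear okubo_mult"
  unfolding bilinear_def
  by (intro conjI allI linearI)
    (simp_all add: okubo_mult_def matrix_expand scaleR_eq_cscale vec_eq_iff mat_def
      algebra_simps add_divide_distrib)

text \<open>A traceless \<open>3 \<times> 3\<close> matrix satisfies \<open>x\<^sup>3 = (tr (x\<^sup>2) / 2) x + (tr (x\<^sup>3) / 3) I\<close> by
  Cayley and Hamilton; the identity below is the derivative of this one at \<open>x\<close> in the direction
  of the traceless matrix \<open>y\<close>. It is verified as a polynomial identity in the entries, the trace
  conditions being used to eliminate the last diagonal entry.\<close>

lemma polarized_Cayley_Hamilton:
  fixes x y :: "complex^3^3"
  assumes "trace x = 0" "trace y = 0"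
  shows "x ** x ** y + x ** y ** x + y ** x ** x =
    cscale (trace (x ** y)) x + cscale (trace (x ** x) / 2) y + mat (trace (x ** x ** y))"
proof -
  have x3: "x $ 3 $ 3 = - x $ 1 $ 1 - x $ 2 $ 2" and y3: "y $ 3 $ 3 = - y $ 1 $ 1 - y $ 2 $ 2"
    using assms by (simp_all add: trace_def sum_3 eq_neg_iff_add_eq_0 algebra_simps)
  show ?thesis
    unfolding vec_eq_iff forall_3
    by (simp add: matrix_matrix_mult_def sum_3 trace_def mat_def x3 y3 algebra_simps
      add_divide_distrib diff_divide_distrib)
qed

text \<open>The scalar computation behind the composition identities, done for a single matrix entry.
  The letters \<open>N\<close>, \<open>x\<close>, \<open>y\<close> and \<open>e\<close> stand for an entry of \<open>xyx\<close>, \<open>x\<close>, \<open>y\<close> and the identity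
  matrix, \<open>A\<close> and \<open>B\<close> for the entry of \<open>xxy\<close> and \<open>yxx\<close> in either order, and \<open>t\<close>, \<open>n\<close>, \<open>T\<close> for
  the traces of \<open>xy\<close>, \<open>xx\<close>, \<open>xxy\<close>. The left-hand side is an expanded twofold Okubo product.\<close>

lemma okubo_coefficients:
  fixes m m' A B N t T n x y e :: complex
  assumes m: "m + m' = 1" "m * m' = 1 / 3"
    and CH: "A + N + B = t * x + n / 2 * y + T * e"
  shows "m * (m * N + m' * B - t / 3 * x) + m' * (m * A + m' * N - t / 3 * x)
    - (m * T + m' * T) / 3 * e = n / 6 * y"
proof -
  have sq: "m * m + m' * m' = 1 / 3"
  proof -
    have "m * m + m' * m' = (m + m') * (m + m') - 2 * (m * m')"
      by (simp add: algebra_simps)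
    then show ?thesis by (simp add: m)
  qed
  have "m * (m * N + m' * B - t / 3 * x) + m' * (m * A + m' * N - t / 3 * x)
    - (m * T + m' * T) / 3 * e = (m * m + m' * m') * N + (m * m') * (A + B)
    - (m + m') * (t * x + T * e) / 3"
    by (simp add: algebra_simps add_divide_distrib diff_divide_distrib)
  also have "\<dots> = (A + N + B - t * x - T * e) / 3"
    by (simp add: m sq add_divide_distrib diff_divide_distrib)
  also have "\<dots> = n / 6 * y" by (simp add: CH)
  finally show ?thesis .
qed

text \<open>Expanding either product gives \<open>(\<mu>\<^sup>2 + (cnj \<mu>)\<^sup>2) xyx + \<mu> cnj \<mu> (xxy + yxx)\<close> up to multiples
  of \<open>x\<close> and of the identity, and all three words occur with coefficient \<open>1/3\<close>.
  This is where Cayley-Hamilton leaves only a multiple of \<open>y\<close>.\<close>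

lemma okubo_mult_flexible:
  fixes x y :: "complex^3^3"
  assumes "trace x = 0" "trace y = 0"
  shows "okubo_mult (okubo_mult x y) x = cscale (trace (x ** x) / 6) y"
    and "okubo_mult x (okubo_mult y x) = cscale (trace (x ** x) / 6) y"
proof -
  have t: "trace (x ** y ** x) = trace (x ** x ** y)" "trace (y ** x ** x) = trace (x ** x ** y)"
    "trace (y ** x) = trace (x ** y)"
    by (metis matrix_mul_assoc trace_mul_sym)+
  have CH: "(x ** x ** y) $ i $ j + (x ** y ** x) $ i $ j + (y ** x ** x) $ i $ j =
    trace (x ** y) * x $ i $ j + trace (x ** x) / 2 * y $ i $ j +
     trace (x ** x ** y) * mat 1 $ i $ j" for i j
    using arg_cong [OF polarized_Cayley_Hamilton [OF assms], of "\<lambda>A. A $ i $ j"]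
    by (simp add: mat_nth_eq [of "trace _"])
  note combine = okubo_coefficients [OF okubo_mu_add_cnj okubo_mu_mult_cnj CH]
  have "(y ** x ** x) $ i $ j + (x ** y ** x) $ i $ j + (x ** x ** y) $ i $ j =
    trace (x ** y) * x $ i $ j + trace (x ** x) / 2 * y $ i $ j +
     trace (x ** x ** y) * mat 1 $ i $ j" for i j
    using CH [of i j] by (simp add: add_ac)
  note combine' = okubo_coefficients [OF okubo_mu_add_cnj okubo_mu_mult_cnj this]
  show "okubo_mult (okubo_mult x y) x = cscale (trace (x ** x) / 6) y"
    using combine
    by (simp add: okubo_mult_def matrix_expand vec_eq_iff matrix_mul_assoc t assms
        mat_nth_eq [of "_ / _"])
  show "okubo_mult x (okubo_mult y x) = cscale (trace (x ** x) / 6) y"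
    using combine'
    by (simp add: okubo_mult_def matrix_expand vec_eq_iff matrix_mul_assoc t assms
        mat_nth_eq [of "_ / _"])
qed

lemma trace_square_hermitian:
  assumes "hermitian (A :: complex^'n^'n)"
  shows "trace (A ** A) = complex_of_real ((norm A)\<^sup>2)"
proof -
  have "A $ i $ j * A $ j $ i = complex_of_real (A $ i $ j \<bullet> A $ i $ j)" for i j
  proof -
    have "A $ j $ i = cnj (A $ i $ j)"
      using hermitian_cnj [OF assms] by simp
    then show ?thesis
      by (metis complex_norm_square power2_norm_eq_inner)
  qed
  then show ?thesis
    by (simp add: trace_def matrix_matrix_mult_def power2_norm_eq_inner inner_vec_def)
qed

text \<open>The identities that make the Okubo algebra a division algebra. Since the multiplier of \<open>y\<close>
  vanishes only for \<open>x = 0\<close>, they invert left and right multiplication by \<open>x\<close> at once.\<close>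

lemma okubo_mult_composition:
  assumes "x \<in> okubo" "y \<in> okubo"
  shows "okubo_mult (okubo_mult x y) x = ((norm x)\<^sup>2 / 6) *\<^sub>R y"
    and "okubo_mult x (okubo_mult y x) = ((norm x)\<^sup>2 / 6) *\<^sub>R y"
  using assms
  by (simp_all add: okubo_def okubo_mult_flexible trace_square_hermitian scaleR_eq_cscale)

lemma okubo_no_zero_divisors:
  assumes "x \<in> okubo" "y \<in> okubo" "okubo_mult x y = 0"
  shows "x = 0 \<or> y = 0"
proof -
  have "((norm x)\<^sup>2 / 6) *\<^sub>R y = 0"
    using okubo_mult_composition(1) [OF assms(1,2)] assms(3)
    by (simp add: bilinear_lzero [OF bilinear_okubo_mult])
  then show ?thesis by simp
qed

lemma okubo_left_division:
  assumes "s \<in> okubo" "s \<noteq> 0" "b \<in> okubo"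
  obtains x where "x \<in> okubo" "okubo_mult s x = b"
proof
  let ?x = "(6 / (norm s)\<^sup>2) *\<^sub>R okubo_mult b s"
  show "?x \<in> okubo"
    using assms by (intro subspace_mul [OF subspace_okubo] okubo_mult_closed)
  show "okubo_mult s ?x = b"
    using assms by (simp add: bilinear_rmul [OF bilinear_okubo_mult] okubo_mult_composition)
qed

lemma okubo_right_division:
  assumes "x \<in> okubo" "x \<noteq> 0" "b \<in> okubo"
  obtains s where "s \<in> okubo" "okubo_mult s x = b"
proof
  let ?s = "(6 / (norm x)\<^sup>2) *\<^sub>R okubo_mult x b"
  show "?s \<in> okubo"
    using assms by (intro subspace_mul [OF subspace_okubo] okubo_mult_closed)
  show "okubo_mult ?s x = b"
    using assms by (simp add: bilinear_lmul [OF bilinear_okubo_mult] okubo_mult_composition)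
qed

section \<open>Joins and meets in the completed plane\<close>

lemma mem_line [simp]:
  "Affine x y \<in> line s t \<longleftrightarrow> x \<in> okubo \<and> y = okubo_mult s x + t"
  "Slope u \<in> line s t \<longleftrightarrow> u = s"
  "Infinity \<notin> line s t"
  by (auto simp: line_def)

lemma mem_vertical_line [simp]:
  "Affine x y \<in> vertical_line c \<longleftrightarrow> x = c \<and> y \<in> okubo"
  "Slope u \<notin> vertical_line c"
  "Infinity \<in> vertical_line c"
  by (auto simp: vertical_line_def)

lemma mem_line_at_infinity [simp]:
  "Affine x y \<notin> line_at_infinity"
  "Slope u \<in> line_at_infinity \<longleftrightarrow> u \<in> okubo"
  "Infinity \<in> line_at_infinity"
  by (auto simp: line_at_infinity_def)

lemma mem_okubic_points [simp]:
  "Affine x y \<in> okubic_points \<longleftrightarrow> x \<in> okubo \<and> y \<in> okubo"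
  "Slope u \<in> okubic_points \<longleftrightarrow> u \<in> okubo"
  "Infinity \<in> okubic_points"
  by (auto simp: okubic_points_def)

lemma okubic_lines_intros:
  "s \<in> okubo \<Longrightarrow> t \<in> okubo \<Longrightarrow> line s t \<in> okubic_lines"
  "c \<in> okubo \<Longrightarrow> vertical_line c \<in> okubic_lines"
  "line_at_infinity \<in> okubic_lines"
  by (auto simp: okubic_lines_def)

lemma okubic_lines_cases:
  assumes "l \<in> okubic_lines"
  obtains s t where "l = line s t" "s \<in> okubo" "t \<in> okubo"
  | c where "l = vertical_line c" "c \<in> okubo"
  | "l = line_at_infinity"
  using assms by (auto simp: okubic_lines_def)

lemma okubic_lines_subset_points:
  assumes "l \<in> okubic_lines"
  shows "l \<subseteq> okubic_points"
  using assms
  by (auto simp: okubic_lines_def line_def vertical_line_def line_at_infinity_def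
      intro!: subspace_add [OF subspace_okubo] okubo_mult_closed)

text \<open>The slope of the join solves \<open>s * (x - x') = y - y'\<close>, which needs \<open>x \<noteq> x'\<close>; points with equal
  abscissae lie on a vertical line.\<close>

lemma okubic_affine_join:
  assumes "x \<in> okubo" "y \<in> okubo" "x' \<in> okubo" "y' \<in> okubo"
  shows "\<exists>l\<in>okubic_lines. Affine x y \<in> l \<and> Affine x' y' \<in> l"
proof (cases "x = x'")
  case True
  then show ?thesis
    using assms by (intro bexI [of _ "vertical_line x"]) (auto intro: okubic_lines_intros)
next
  case False
  have diff: "x - x' \<in> okubo" "y - y' \<in> okubo"
    using assms by (simp_all add: subspace_diff [OF subspace_okubo])
  from False diff obtain s where s: "s \<in> okubo" "okubo_mult s (x - x') = y - y'"
    by (metis okubo_right_division right_minus_eq)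
  let ?t = "y - okubo_mult s x"
  have "y' = okubo_mult s x' + ?t"
    using s(2) by (simp add: bilinear_rsub [OF bilinear_okubo_mult] algebra_simps)
  moreover have "?t \<in> okubo"
    using assms s by (simp add: subspace_diff [OF subspace_okubo] okubo_mult_closed)
  ultimately show ?thesis
    using assms s by (intro bexI [of _ "line s ?t"]) (auto intro: okubic_lines_intros)
qed

lemma okubic_slope_join:
  assumes "x \<in> okubo" "y \<in> okubo" "s \<in> okubo"
  shows "\<exists>l\<in>okubic_lines. Affine x y \<in> l \<and> Slope s \<in> l"
proof -
  have "y - okubo_mult s x \<in> okubo"
    using assms by (simp add: subspace_diff [OF subspace_okubo] okubo_mult_closed)
  then show ?thesis
    using assms
    by (intro bexI [of _ "line s (y - okubo_mult s x)"]) (auto intro: okubic_lines_intros)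
qed

lemma okubic_join_exists:
  assumes "p \<in> okubic_points" "q \<in> okubic_points"
  shows "\<exists>l\<in>okubic_lines. p \<in> l \<and> q \<in> l"
proof -
  \<comment> \<open>Keeping the relation opaque lets its symmetry halve the cases on the kinds of points.\<close>
  define joined where "joined p q \<longleftrightarrow> (\<exists>l\<in>okubic_lines. p \<in> l \<and> q \<in> l)" for p q
  have sym: "joined q p" if "joined p q" for p q
    using that by (auto simp: joined_def)
  have affine: "joined (Affine x y) (Affine x' y')"
    if "x \<in> okubo" "y \<in> okubo" "x' \<in> okubo" "y' \<in> okubo" for x y x' y'
    using okubic_affine_join [OF that] by (simp add: joined_def)
  have slope: "joined (Affine x y) (Slope s)"
    if "x \<in> okubo" "y \<in> okubo" "s \<in> okubo" for x y s
    using okubic_slope_join [OF that] by (simp add: joined_def)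
  have vertical: "joined (Affine x y) Infinity" if "x \<in> okubo" "y \<in> okubo" for x y
    unfolding joined_def using that
    by (intro bexI [of _ "vertical_line x"]) (auto intro: okubic_lines_intros)
  have infinite: "joined p q" if "p \<in> line_at_infinity" "q \<in> line_at_infinity" for p q
    using that okubic_lines_intros(3) by (auto simp: joined_def)
  have "joined p q"
    using assms
    by (cases p; cases q) (simp_all add: affine slope vertical infinite sym [OF slope] sym [OF vertical])
  then show ?thesis
    by (simp add: joined_def)
qed

text \<open>Parallel lines meet in their slope; otherwise the abscissa of the meet solves
  \<open>(s - s') * x = t' - t\<close>.\<close>

lemma okubic_line_meet:
  assumes "s \<in> okubo" "t \<in> okubo" "s' \<in> okubo" "t' \<in> okubo"
  shows "\<exists>p. p \<in> line s t \<and> p \<in> line s' t'"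
proof (cases "s = s'")
  case True
  then show ?thesis by (intro exI [of _ "Slope s"]) auto
next
  case False
  have "s - s' \<in> okubo" "t' - t \<in> okubo"
    using assms by (simp_all add: subspace_diff [OF subspace_okubo])
  with False obtain x where x: "x \<in> okubo" "okubo_mult (s - s') x = t' - t"
    by (metis okubo_left_division right_minus_eq)
  then have "okubo_mult s x + t = okubo_mult s' x + t'"
    by (simp add: bilinear_lsub [OF bilinear_okubo_mult] algebra_simps)
  then show ?thesis
    using x by (intro exI [of _ "Affine x (okubo_mult s x + t)"]) auto
qed

lemma okubic_meet_exists:
  assumes "l \<in> okubic_lines" "m \<in> okubic_lines"
  shows "\<exists>p. p \<in> l \<and> p \<in> m"
proof -
  \<comment> \<open>Opaque for the same reason as in the proof that joins exist.\<close>
  define meets where "meets l m \<longleftrightarrow> (\<exists>p :: (complex^3^3) point. p \<in> l \<and> p \<in> m)" for l m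
  have sym: "meets m l" if "meets l m" for l m
    using that by (auto simp: meets_def)
  have slope: "meets (line s t) (line s' t')"
    if "s \<in> okubo" "t \<in> okubo" "s' \<in> okubo" "t' \<in> okubo" for s t s' t'
    using okubic_line_meet [OF that] by (simp add: meets_def)
  have vertical: "meets (line s t) (vertical_line c)"
    if "s \<in> okubo" "t \<in> okubo" "c \<in> okubo" for s t c
    unfolding meets_def using that
    by (intro exI [of _ "Affine c (okubo_mult s c + t)"])
      (auto intro: subspace_add [OF subspace_okubo] okubo_mult_closed)
  have infinite: "meets (line s t) line_at_infinity" if "s \<in> okubo" for s t
    unfolding meets_def using that by (intro exI [of _ "Slope s"]) auto
  have at_Infinity: "meets l m" if "Infinity \<in> l" "Infinity \<in> m" for l m
    using that by (auto simp: meets_def)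
  have "meets l m"
    using assms unfolding okubic_lines_def
    by (auto intro: slope vertical infinite at_Infinity sym [OF vertical] sym [OF infinite])
  then show ?thesis
    by (simp add: meets_def)
qed

text \<open>If both common points are affine then, combining the four incidence equations gives
  \<open>(s - s') * (x - x') = 0\<close>, and the absence of zero divisors yields \<open>s = s'\<close>. A common point at
  infinity yields this directly.\<close>

lemma okubic_line_determined:
  assumes "s \<in> okubo" "s' \<in> okubo"
    and "p \<noteq> q" "p \<in> line s t" "q \<in> line s t" "p \<in> line s' t'" "q \<in> line s' t'"
  shows "s = s' \<and> t = t'"
proof -
  have slope: "s = s'"
    if x: "x \<in> okubo" "x' \<in> okubo" "x \<noteq> x'"
      and eq: "okubo_mult s x + t = okubo_mult s' x + t'"
        "okubo_mult s x' + t = okubo_mult s' x' + t'" for x x'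
  proof -
    have "okubo_mult (s - s') (x - x') =
        (okubo_mult s x + t - (okubo_mult s' x + t')) -
        (okubo_mult s x' + t - (okubo_mult s' x' + t'))"
      by (simp add: bilinear_lsub [OF bilinear_okubo_mult]
          bilinear_rsub [OF bilinear_okubo_mult])
    then have "okubo_mult (s - s') (x - x') = 0"
      using eq by simp
    moreover have "s - s' \<in> okubo" "x - x' \<in> okubo"
      using assms x by (simp_all add: subspace_diff [OF subspace_okubo])
    ultimately show ?thesis
      using okubo_no_zero_divisors x(3) by fastforce
  qed
  show ?thesis
    using assms(3-)
    by (cases p; cases q) (auto dest: slope)
qed

text \<open>Carries both uniqueness claims: joins are unique because of it, and two distinct lines with two
  common points would contradict it.\<close>

lemma okubic_lines_determined:
  assumes "l \<in> okubic_lines" "m \<in> okubic_lines"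
    and "p \<noteq> q" "p \<in> l" "q \<in> l" "p \<in> m" "q \<in> m"
  shows "l = m"
  using assms(1)
proof (cases rule: okubic_lines_cases)
  case l: (1 s t)
  show ?thesis
    using assms(2)
  proof (cases rule: okubic_lines_cases)
    case (1 s' t')
    then show ?thesis
      using l assms okubic_line_determined by metis
  next
    case 2
    then show ?thesis using l assms by (cases p; cases q) auto
  next
    case 3
    then show ?thesis using l assms by (cases p; cases q) auto
  qed
next
  case l: (2 c)
  show ?thesis
    using assms(2)
    by (cases rule: okubic_lines_cases) (use l assms in \<open>cases p; cases q; auto\<close>)+
next
  case l: 3
  show ?thesis
    using assms(2)
    by (cases rule: okubic_lines_cases) (use l assms in \<open>cases p; cases q; auto\<close>)+
qed

section \<open>A quadrangle\<close>

lemma okubo_nonzero_element: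
  obtains a where "a \<in> okubo" "a \<noteq> 0"
proof
  let ?a = "(\<chi> i j. if i = j then if i = 1 then 1 else if i = 2 then - 1 else 0 else 0)
    :: complex^3^3"
  show "?a \<in> okubo"
    by (simp add: okubo_def hermitian_def trace_def sum_3)
  have "?a $ 1 $ 1 \<noteq> 0"
    by simp
  then show "?a \<noteq> 0"
    by (metis zero_index)
qed

text \<open>The quadrangle consists of the origin, the two points at infinity on the axes, and a point
  \<open>(a, a)\<close> with \<open>a \<noteq> 0\<close>, which lies on none of the two axes and the line at infinity that join
  the other three. On a non-vertical line through the origin \<open>t = 0\<close>, and \<open>s = 0\<close> would force
  \<open>a = 0\<close>, so the slope of the line to \<open>(a, a)\<close> differs from both chosen points at infinity.\<close>

lemma okubic_quadrangle:
  "\<exists>Q\<subseteq>okubic_points. card Q = 4 \<and> (\<forall>T\<subseteq>Q. card T = 3 \<longrightarrow> \<not> (\<exists>l\<in>okubic_lines. T \<subseteq> l))"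
proof -
  obtain a where a: "a \<in> okubo" "a \<noteq> 0"
    by (rule okubo_nonzero_element)
  let ?Q = "{Affine 0 0, Slope 0, Infinity, Affine a a}"
  have zero: "0 \<in> okubo"
    by (rule subspace_0 [OF subspace_okubo])
  have mult_zero: "okubo_mult 0 x = 0" for x
    by (rule bilinear_lzero [OF bilinear_okubo_mult])
  have "\<not> T \<subseteq> l" if T: "T \<subseteq> ?Q" "card T = 3" and l: "l \<in> okubic_lines" for T l
  proof
    assume "T \<subseteq> l"
    \<comment> \<open>A three-element subset omits exactly one of the four points.\<close>
    have "card (?Q - T) = 1"
      using T a by (subst card_Diff_subset) (auto intro: finite_subset)
    then obtain q where "?Q - T = {q}"
      by (rule card_1_singletonE)
    then have rest: "r \<in> l" if "r \<in> ?Q" "r \<noteq> q" for r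
      using that \<open>T \<subseteq> l\<close> by blast
    have on_l: "Slope 0 \<in> l \<and> Infinity \<in> l \<and> Affine a a \<in> l \<or>
        Affine 0 0 \<in> l \<and> Infinity \<in> l \<and> Affine a a \<in> l \<or>
        Affine 0 0 \<in> l \<and> Slope 0 \<in> l \<and> Affine a a \<in> l \<or>
        Affine 0 0 \<in> l \<and> Slope 0 \<in> l \<and> Infinity \<in> l"
      using rest [of "Affine 0 0"] rest [of "Slope 0"] rest [of Infinity] rest [of "Affine a a"]
        a(2) by auto
    from l show False
    proof (cases rule: okubic_lines_cases)
      case (1 s t)
      with a on_l show False
        by (auto simp: mult_zero bilinear_rzero [OF bilinear_okubo_mult])
    next
      case (2 c)
      with a on_l show False by auto
    next
      case 3
      with on_l show False by auto
    qed
  qed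
  moreover have "?Q \<subseteq> okubic_points" "card ?Q = 4"
    using a zero by auto
  ultimately show ?thesis by blast
qed

theorem theorem6:
  shows "projective_plane okubic_points okubic_lines"
  unfolding projective_plane_def
proof (intro conjI ballI impI okubic_quadrangle)
  fix p q assume "p \<in> okubic_points" "q \<in> okubic_points" "p \<noteq> q"
  then show "\<exists>!l. l \<in> okubic_lines \<and> p \<in> l \<and> q \<in> l"
    using okubic_join_exists okubic_lines_determined by (metis (no_types, lifting))
next
  fix l m assume lm: "l \<in> okubic_lines" "m \<in> okubic_lines" "l \<noteq> m"
  then obtain p where "p \<in> l" "p \<in> m"
    using okubic_meet_exists by blast
  then show "\<exists>!p. p \<in> okubic_points \<and> p \<in> l \<and> p \<in> m"
    using lm okubic_lines_subset_points okubic_lines_determined by blast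
qed

end
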